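(* Let $n\ge1$ and fix a permutation $\eta=(\eta_1,\dots,\eta_n)$ of $\{1,\dots,n\}$; put $P_\eta=\{(1,\eta_1),\dots,(n,\eta_n)\}$. Let $\mathcal C$ be the set of complete non-ambiguous forests (with $n$ leaves) whose set of leaves is $P_\eta$. Let $\mathcal P$ be the set of pairs $(\alpha,\beta)$, $\alpha=(a_1,\dots,a_n)$, $\beta=(b_1,\dots,b_n)$ permutations of $\{1,\dots,n\}$, with no common rise and with $\{(a_1,b_1),\dots,(a_n,b_n)\}=P_\eta$. Then there exists a bijection between $\mathcal C$ and $\mathcal P$; in particular $|\mathcal C|=|\mathcal P|$.
   Context: A non-ambiguous forest is a finite set $A\subseteq\mathbb N^+\times\mathbb N^+$ of points $p=(x(p),y(p))$ such that: (i) if some point has first coordinate $x$ then every $1\le x'<x$ is the first coordinate of some point, and likewise for second coordinates; (ii) there is no $p\in A$ for which there exist both $q\in A$ with $x(q)=x(p)$, $y(q)<y(p)$ and $s\in A$ with $y(s)=y(p)$, $x(s)<x(p)$. Its forest structure: the parent of $p$ is the point $q\in A$ with $x(q)=x(p)$, $y(q)<y(p)$ and $y(q)$ maximal if one exists, otherwise the point $s\in A$ with $y(s)=y(p)$, $x(s)<x(p)$ and $x(s)$ maximal if one exists, otherwise $p$ is a root. Leaves are points with no children; the forest is complete if every point has $0$ or $2$ children. The pair $(\alpha,\beta)$ has a common rise at $i$ ($1\le i\le n-1$) if $a_i<a_{i+1}$ and $b_i<b_{i+1}$. *)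

theory Defs
  imports "HOL-Combinatorics.Permutations"
begin

type_synonym point = "nat \<times> nat"

definition below :: "point set \<Rightarrow> point \<Rightarrow> point set" where
  "below A p = {q \<in> A. fst q = fst p \<and> snd q < snd p}"

definition leftward :: "point set \<Rightarrow> point \<Rightarrow> point set" where
  "leftward A p = {s \<in> A. snd s = snd p \<and> fst s < fst p}"

definition nonambiguous_forest :: "point set \<Rightarrow> bool" where
  "nonambiguous_forest A \<longleftrightarrow>
     finite A \<and>
     (\<forall>p\<in>A. 1 \<le> fst p \<and> 1 \<le> snd p) \<and>
     (\<forall>p\<in>A. \<forall>x'. 1 \<le> x' \<and> x' < fst p \<longrightarrow> (\<exists>q\<in>A. fst q = x')) \<and>
     (\<forall>p\<in>A. \<forall>y'. 1 \<le> y' \<and> y' < snd p \<longrightarrow> (\<exists>q\<in>A. snd q = y')) \<and>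
     \<not> (\<exists>p\<in>A. (\<exists>q. q \<in> below A p) \<and> (\<exists>s. s \<in> leftward A p))"

text \<open>The value \<open>None\<close> marks a root. The sets under \<open>Max\<close> are finite and nonempty whenever
  \<open>A\<close> is finite.\<close>

definition parent :: "point set \<Rightarrow> point \<Rightarrow> point option" where
  "parent A p =
     (if below A p \<noteq> {} then Some (fst p, Max (snd ` below A p))
      else if leftward A p \<noteq> {} then Some (Max (fst ` leftward A p), snd p)
      else None)"

definition children :: "point set \<Rightarrow> point \<Rightarrow> point set" where
  "children A p = {q \<in> A. parent A q = Some p}"

definition leaves :: "point set \<Rightarrow> point set" where
  "leaves A = {p \<in> A. children A p = {}}"

definition complete_forest :: "point set \<Rightarrow> bool" where
  "complete_forest A \<longleftrightarrow>
     nonambiguous_forest A \<and> (\<forall>p\<in>A. card (children A p) = 0 \<or> card (children A p) = 2)"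

text \<open>A permutation \<open>(c\<^sub>1, \<dots>, c\<^sub>n)\<close> is a function \<open>c\<close> with \<open>c permutes {1..n}\<close>; since such
  functions are the identity outside \<open>{1..n}\<close>, each permutation is represented exactly once.\<close>

definition common_rise_at :: "nat \<Rightarrow> (nat \<Rightarrow> nat) \<Rightarrow> (nat \<Rightarrow> nat) \<Rightarrow> nat \<Rightarrow> bool" where
  "common_rise_at n a b i \<longleftrightarrow> 1 \<le> i \<and> i \<le> n - 1 \<and> a i < a (i + 1) \<and> b i < b (i + 1)"

definition perm_points :: "nat \<Rightarrow> (nat \<Rightarrow> nat) \<Rightarrow> point set" where
  "perm_points n \<eta> = {(i, \<eta> i) | i. i \<in> {1..n}}"

definition forests_with_leaves :: "nat \<Rightarrow> (nat \<Rightarrow> nat) \<Rightarrow> point set set" where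
  "forests_with_leaves n \<eta> = {A. complete_forest A \<and> leaves A = perm_points n \<eta>}"

definition no_common_rise_pairs :: "nat \<Rightarrow> (nat \<Rightarrow> nat) \<Rightarrow> ((nat \<Rightarrow> nat) \<times> (nat \<Rightarrow> nat)) set" where
  "no_common_rise_pairs n \<eta> =
     {(a, b). a permutes {1..n} \<and> b permutes {1..n} \<and>
        (\<nexists>i. common_rise_at n a b i) \<and>
        {(a i, b i) | i. i \<in> {1..n}} = perm_points n \<eta>}"

end

theory Submission
  imports Defs
begin

text \<open>
  In a complete non-ambiguous forest the leaf set \<open>S\<close> has one point per column and row, and an
  internal point is the lower left corner of the rectangle spanned by the leaf \<open>p\<close> topping its
  column and the leaf \<open>q\<close> ending its row. A pair \<open>(\<alpha>, \<beta>)\<close> without common rise is an ordering of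
  \<open>S\<close> without a step that increases both coordinates.

  Let \<open>l\<close> be the leftmost and \<open>m\<close> the lowest point of \<open>S\<close>. No step into \<open>l\<close> or \<open>m\<close> increases both
  coordinates, so cutting an ordering before \<open>l\<close> gives
  \<open>N(S) = \<Sum>\<^bsub>l \<in> B\<^esub> R\<^sub>l(B) N(S - B)\<close>, where \<open>R\<^sub>a\<close> counts the orderings starting at \<open>a\<close>, and cutting
  before \<open>m\<close> gives \<open>R\<^sub>l(S) = \<Sum>\<^bsub>m \<in> B, l \<notin> B\<^esub> R\<^sub>m(B) R\<^sub>l(S - B)\<close>, and likewise with \<open>l\<close> and \<open>m\<close>
  exchanged. The numbers \<open>G\<close> of forests and \<open>T\<close> of trees satisfy the same recursions: split off the
  component of \<open>l\<close>, respectively delete the root, which lies in the column of \<open>l\<close> and the row of \<open>m\<close>.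
  By induction \<open>R\<^sub>l = R\<^sub>m = T\<close> and hence \<open>N = G\<close>.
\<close>

section \<open>Orderings, forests and trees over a set of leaves\<close>

definition steep :: "point \<Rightarrow> point \<Rightarrow> bool" where
  "steep p q \<longleftrightarrow> \<not> (fst p < fst q \<and> snd p < snd q)"

definition words :: "point set \<Rightarrow> point list set" where
  "words S = {w. distinct w \<and> set w = S \<and> successively steep w}"

definition words_from :: "point \<Rightarrow> point set \<Rightarrow> point list set" where
  "words_from a S = {w \<in> words S. w \<noteq> [] \<and> hd w = a}"

definition general_position :: "point set \<Rightarrow> bool" where
  "general_position S \<longleftrightarrow> finite S \<and> inj_on fst S \<and> inj_on snd S"

text \<open>The candidates for internal points, indexed by the inversions of \<open>S\<close>: the
  column comes from the upper left leaf and the row from the lower right one.\<close>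

definition corners :: "point set \<Rightarrow> point set" where
  "corners S = {(fst p, snd q) | p q. p \<in> S \<and> q \<in> S \<and> fst p < fst q \<and> snd q < snd p}"

definition unambiguous :: "point set \<Rightarrow> bool" where
  "unambiguous A \<longleftrightarrow> (\<forall>p\<in>A. below A p = {} \<or> leftward A p = {})"

text \<open>For \<open>S\<close> in general position completeness is built in: a corner has its two
  leaves above it and to its right, while a leaf has nothing there. The coordinates need not fill an
  initial segment, so the notion passes to subsets of the leaves.\<close>

definition forests_on :: "point set \<Rightarrow> point set set" where
  "forests_on S = {A. S \<subseteq> A \<and> A \<subseteq> S \<union> corners S \<and> unambiguous A}"

text \<open>For \<open>B\<close> a set of leaves: no internal point of \<open>A\<close> joins a leaf in \<open>B\<close> to a leaf outside \<open>B\<close>.\<close>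

definition splits :: "point set \<Rightarrow> point set \<Rightarrow> bool" where
  "splits A B \<longleftrightarrow> (\<forall>p\<in>A. fst p \<in> fst ` B \<longleftrightarrow> snd p \<in> snd ` B)"

text \<open>Connectedness is stated through sets of leaves instead of paths to a root. The empty set
  is a tree on \<open>{}\<close>, but the recursions only count trees on nonempty leaf sets.\<close>

definition trees_on :: "point set \<Rightarrow> point set set" where
  "trees_on S = {A \<in> forests_on S. \<forall>B\<subseteq>S. splits A B \<longrightarrow> B = {} \<or> B = S}"

text \<open>Selecting by columns also selects by rows as soon as \<open>B\<close> splits
  \<open>A\<close>.\<close>

definition columns_of :: "point set \<Rightarrow> point set \<Rightarrow> point set" where
  "columns_of A B = {p \<in> A. fst p \<in> fst ` B}"

section \<open>General position and finiteness\<close>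

lemma general_position_subset:
  "general_position S \<Longrightarrow> B \<subseteq> S \<Longrightarrow> general_position B"
  unfolding general_position_def by (meson finite_subset inj_on_subset)

lemma general_position_fst_image_iff:
  "general_position S \<Longrightarrow> B \<subseteq> S \<Longrightarrow> p \<in> S \<Longrightarrow> fst p \<in> fst ` B \<longleftrightarrow> p \<in> B"
  unfolding general_position_def by (meson inj_on_image_mem_iff)

lemma general_position_snd_image_iff:
  "general_position S \<Longrightarrow> B \<subseteq> S \<Longrightarrow> p \<in> S \<Longrightarrow> snd p \<in> snd ` B \<longleftrightarrow> p \<in> B"
  unfolding general_position_def by (meson inj_on_image_mem_iff)

lemma finite_words: "finite S \<Longrightarrow> finite (words S)"
  by (rule finite_subset[OF _ finite_subset_distinct[of S]]) (auto simp: words_def)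

lemma finite_words_from: "finite S \<Longrightarrow> finite (words_from a S)"
  by (rule finite_subset[OF _ finite_words[of S]]) (auto simp: words_from_def)

lemma finite_corners: "finite S \<Longrightarrow> finite (corners S)"
  by (rule finite_subset[of _ "fst ` S \<times> snd ` S"]) (auto simp: corners_def rev_image_eqI)

lemma finite_forests_on: "finite S \<Longrightarrow> finite (forests_on S)"
  by (rule finite_subset[of _ "Pow (S \<union> corners S)"]) (auto simp: forests_on_def finite_corners)

lemma finite_trees_on: "finite S \<Longrightarrow> finite (trees_on S)"
  by (rule finite_subset[OF _ finite_forests_on[of S]]) (auto simp: trees_on_def)

lemma card_Sigma_times:
  assumes "finite I" "\<And>i. i \<in> I \<Longrightarrow> finite (X i)" "\<And>i. i \<in> I \<Longrightarrow> finite (Y i)"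
  shows "card (SIGMA i:I. X i \<times> Y i) = (\<Sum>i\<in>I. card (X i) * card (Y i))"
  using assms by (simp add: card_SigmaI card_cartesian_product)

section \<open>Recursions for orderings\<close>

text \<open>The leftmost and the lowest point satisfy the condition on \<open>b\<close>, so any word
  on the remaining points may be placed in front of a word starting at \<open>b\<close>; the only
  new step is the one into \<open>b\<close>.\<close>

lemma append_in_words:
  assumes "u \<in> words (S - B)" "v \<in> words_from b B" "B \<subseteq> S" "\<forall>p\<in>S. steep p b"
  shows "u @ v \<in> words S"
proof -
  have "u \<noteq> [] \<Longrightarrow> steep (last u) b"
    using assms(1,4) last_in_set[of u] by (auto simp: words_def)
  then show ?thesis
    using assms(1-3) by (auto simp: words_def words_from_def successively_append_iff)
qed

lemma words_split:
  assumes "w \<in> words S" "b \<in> S"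
  obtains u v where "w = u @ v" "v \<in> words_from b (set v)" "u \<in> words (S - set v)"
    "set v \<subseteq> S" "b \<in> set v"
proof -
  have "b \<in> set w" using assms by (simp add: words_def)
  then obtain u v where w: "w = u @ b # v" by (meson split_list)
  show ?thesis
  proof
    show "w = u @ (b # v)" by (fact w)
    show "b # v \<in> words_from b (set (b # v))" "u \<in> words (S - set (b # v))"
      "set (b # v) \<subseteq> S" "b \<in> set (b # v)"
      using assms(1) w by (auto simp: words_def words_from_def successively_append_iff)
  qed
qed

text \<open>The point \<open>b\<close> occurs exactly once in \<open>u @ v\<close>, as the head of
  \<open>v\<close>. This recovers the place of the cut, and \<open>B\<close> is the set of points of
  \<open>v\<close>.\<close>

lemma inj_on_append_words:
  "inj_on (\<lambda>(B, v, u). u @ v)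
     (SIGMA B:{B. B \<subseteq> S \<and> b \<in> B}. words_from b B \<times> words (S - B))"
proof (rule inj_onI, clarsimp)
  fix B v u B' v' u'
  assume B: "b \<in> B" "b \<in> B'" and v: "v \<in> words_from b B" "v' \<in> words_from b B'"
    and u: "u \<in> words (S - B)" "u' \<in> words (S - B')" and eq: "u @ v = u' @ v'"
  obtain t t' where t: "v = b # t" "v' = b # t'"
    using v unfolding words_from_def by (metis (mono_tags, lifting) list.collapse mem_Collect_eq)
  have "b \<notin> set u" "b \<notin> set t"
    using u B v t by (auto simp: words_def words_from_def)
  then have "u = u' \<and> t = t'"
    using eq append_Cons_eq_iff[of b u t u' t'] unfolding t by simp
  then show "B = B' \<and> v = v' \<and> u = u'"
    using v t by (auto simp: words_from_def words_def)
qed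

text \<open>The set \<open>B\<close> consists of \<open>b\<close> and all that follows it; what
  precedes \<open>b\<close> is an arbitrary word on \<open>S - B\<close>, possibly empty.\<close>

lemma card_words_rec:
  assumes "finite S" "b \<in> S" "\<forall>p\<in>S. steep p b"
  shows "card (words S) =
    (\<Sum>B\<in>{B. B \<subseteq> S \<and> b \<in> B}. card (words_from b B) * card (words (S - B)))"
proof -
  let ?D = "SIGMA B:{B. B \<subseteq> S \<and> b \<in> B}. words_from b B \<times> words (S - B)"
  have "(\<lambda>(B, v, u). u @ v) ` ?D = words S"
  proof safe
    fix B u v assume "b \<in> B" "B \<subseteq> S" "v \<in> words_from b B" "u \<in> words (S - B)"
    then show "u @ v \<in> words S" using append_in_words assms by blast
  next
    fix w assume "w \<in> words S"
    then obtain u v where "w = u @ v" "v \<in> words_from b (set v)" "u \<in> words (S - set v)"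
      "set v \<subseteq> S" "b \<in> set v"
      using words_split assms(2) by blast
    then show "w \<in> (\<lambda>(B, v, u). u @ v) ` ?D"
      by (intro image_eqI[of _ _ "(set v, v, u)"]) auto
  qed
  then have "card (words S) = card ?D"
    using card_image[OF inj_on_append_words[of S b]] by simp
  also have "\<dots> = (\<Sum>B\<in>{B. B \<subseteq> S \<and> b \<in> B}. card (words_from b B) * card (words (S - B)))"
    using assms(1) by (intro card_Sigma_times)
      (auto intro: finite_words finite_words_from finite_subset)
  finally show ?thesis .
qed

lemma card_words_from_rec:
  assumes "finite S" "a \<in> S" "b \<in> S" "a \<noteq> b" "\<forall>p\<in>S. steep p b"
  shows "card (words_from a S) =
    (\<Sum>B\<in>{B. B \<subseteq> S \<and> b \<in> B \<and> a \<notin> B}. card (words_from b B) * card (words_from a (S - B)))"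
proof -
  let ?D = "SIGMA B:{B. B \<subseteq> S \<and> b \<in> B \<and> a \<notin> B}. words_from b B \<times> words_from a (S - B)"
  have "(\<lambda>(B, v, u). u @ v) ` ?D = words_from a S"
  proof safe
    fix B u v assume "b \<in> B" "B \<subseteq> S" "v \<in> words_from b B" "u \<in> words_from a (S - B)"
    then show "u @ v \<in> words_from a S"
      using append_in_words[of u S B v b] assms by (auto simp: words_from_def)
  next
    fix w assume w: "w \<in> words_from a S"
    then obtain u v where uv: "w = u @ v" "v \<in> words_from b (set v)" "u \<in> words (S - set v)"
      "set v \<subseteq> S" "b \<in> set v"
      using words_split[of w S b] assms(3) unfolding words_from_def by blast
    \<comment> \<open>As \<open>w\<close> starts at \<open>a\<close>, an empty \<open>u\<close>
      would make \<open>a\<close> the head of \<open>v\<close>, which is \<open>b\<close>. So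
      \<open>a\<close> falls into the front part.\<close>
    have ne: "u \<noteq> []" using w uv assms(4) by (auto simp: words_from_def)
    then have hd: "hd u = a" using w uv by (auto simp: words_from_def)
    then have "a \<notin> set v" using uv ne hd_in_set[of u] by (auto simp: words_def)
    then show "w \<in> (\<lambda>(B, v, u). u @ v) ` ?D"
      using uv ne hd by (intro image_eqI[of _ _ "(set v, v, u)"]) (auto simp: words_from_def)
  qed
  moreover have "inj_on (\<lambda>(B, v, u). u @ v) ?D"
    by (rule inj_on_subset[OF inj_on_append_words[of S b]]) (auto simp: words_from_def)
  ultimately have "card (words_from a S) = card ?D"
    using card_image by fastforce
  also have "\<dots> = (\<Sum>B\<in>{B. B \<subseteq> S \<and> b \<in> B \<and> a \<notin> B}.
      card (words_from b B) * card (words_from a (S - B)))"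
    using assms(1) by (intro card_Sigma_times)
      (auto intro: finite_words_from finite_subset)
  finally show ?thesis .
qed

section \<open>Splitting a forest into components\<close>

lemma forests_on_coords:
  assumes "A \<in> forests_on S" "p \<in> A"
  shows "fst p \<in> fst ` S" "snd p \<in> snd ` S"
proof -
  have "p \<in> S \<or> (\<exists>u\<in>S. \<exists>v\<in>S. p = (fst u, snd v))"
    using assms unfolding forests_on_def corners_def by blast
  then show "fst p \<in> fst ` S" "snd p \<in> snd ` S" by force+
qed

lemma unambiguous_subset: "unambiguous A \<Longrightarrow> A' \<subseteq> A \<Longrightarrow> unambiguous A'"
  unfolding unambiguous_def below_def leftward_def by blast

text \<open>A corner in a column of \<open>B\<close> has its upper left leaf in \<open>B\<close>;
  the splitting condition puts its row into \<open>B\<close> as well, hence also its lower right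
  leaf.\<close>

lemma columns_of_in_forests_on:
  assumes S: "general_position S" and A: "A \<in> forests_on S" and B: "B \<subseteq> S" "splits A B"
  shows "columns_of A B \<in> forests_on B"
proof -
  have "p \<in> B \<union> corners B" if p: "p \<in> A" "fst p \<in> fst ` B" for p
  proof (cases "p \<in> S")
    case True
    then show ?thesis using general_position_fst_image_iff[OF S B(1)] p by blast
  next
    case False
    then obtain u v where uv: "p = (fst u, snd v)" "u \<in> S" "v \<in> S" "fst u < fst v" "snd v < snd u"
      using A p unfolding forests_on_def corners_def by blast
    have "u \<in> B" using general_position_fst_image_iff[OF S B(1)] p uv by (metis fst_conv)
    moreover have "v \<in> B"
      using general_position_snd_image_iff[OF S B(1)] p uv B(2) unfolding splits_def
      by (metis snd_conv)
    ultimately show ?thesis using uv unfolding corners_def by blast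
  qed
  moreover have "unambiguous (columns_of A B)"
    using A unambiguous_subset[of A] by (auto simp: forests_on_def columns_of_def)
  ultimately show ?thesis
    using A B(1) by (auto simp: forests_on_def columns_of_def)
qed

text \<open>Together with \<open>splits_Int\<close> and \<open>splits_self\<close> this makes the
  splitting sets of leaves of a forest a Boolean algebra; its atoms are the leaf sets of the trees
  of the forest. General position lets the coordinate projections commute with the set
  operations.\<close>

lemma splits_Diff:
  assumes S: "general_position S" and B: "B \<subseteq> S" "C \<subseteq> S"
    "splits A B" "splits A C"
  shows "splits A (B - C)"
proof -
  have "fst ` (B - C) = fst ` B - fst ` C" "snd ` (B - C) = snd ` B - snd ` C"
    using S B(1,2) unfolding general_position_def by (metis Diff_subset inj_on_image_set_diff order_trans)+
  then show ?thesis using B(3,4) unfolding splits_def by auto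
qed

lemma splits_Int:
  assumes S: "general_position S" and B: "B \<subseteq> S" "C \<subseteq> S"
    "splits A B" "splits A C"
  shows "splits A (B \<inter> C)"
proof -
  have "fst ` (B \<inter> C) = fst ` B \<inter> fst ` C" "snd ` (B \<inter> C) = snd ` B \<inter> snd ` C"
    using S B(1,2) unfolding general_position_def by (metis inj_on_image_Int)+
  then show ?thesis using B(3,4) unfolding splits_def by auto
qed

lemma splits_self: "A \<in> forests_on S \<Longrightarrow> splits A S"
  using forests_on_coords unfolding splits_def by blast

text \<open>A point of \<open>A\<close> outside the columns of \<open>B\<close> has its row outside
  \<open>B\<close> too, so neither of its coordinates occurs in \<open>C\<close>.\<close>

lemma splits_columns_of:
  assumes "splits A B" "C \<subseteq> B" "splits (columns_of A B) C"
  shows "splits A C"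
  using assms unfolding splits_def columns_of_def by (smt (verit) image_mono mem_Collect_eq subsetD)

lemma splits_subset: "splits A B \<Longrightarrow> A' \<subseteq> A \<Longrightarrow> splits A' B"
  unfolding splits_def by blast

lemma general_position_image_disjoint:
  assumes "general_position S" "B \<subseteq> S"
  shows "fst ` B \<inter> fst ` (S - B) = {}" "snd ` B \<inter> snd ` (S - B) = {}"
  using assms unfolding general_position_def inj_on_def by fast+

text \<open>The two parts share no row and no column, so the points below and to the left of a point
  are those of its own part.\<close>

lemma forests_on_Un:
  assumes S: "general_position S" "B \<subseteq> S"
    and A: "A1 \<in> forests_on B" "A2 \<in> forests_on (S - B)"
  shows "A1 \<union> A2 \<in> forests_on S" "splits (A1 \<union> A2) B"
    "columns_of (A1 \<union> A2) B = A1" "columns_of (A1 \<union> A2) (S - B) = A2"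
proof -
  note d = general_position_image_disjoint[OF S]
  note c1 = forests_on_coords[OF A(1)] and c2 = forests_on_coords[OF A(2)]
  have neq: "fst p \<noteq> fst q \<and> snd p \<noteq> snd q" if "p \<in> A1" "q \<in> A2" for p q
    using c1[OF that(1)] c2[OF that(2)] d by (metis IntI empty_iff)
  have "below (A1 \<union> A2) p = below A1 p \<and> leftward (A1 \<union> A2) p = leftward A1 p" if "p \<in> A1" for p
    unfolding below_def leftward_def by (auto dest: neq[OF that])
  moreover have "below (A1 \<union> A2) p = below A2 p \<and> leftward (A1 \<union> A2) p = leftward A2 p"
    if "p \<in> A2" for p
    unfolding below_def leftward_def by (auto dest: neq[OF _ that])
  ultimately have "unambiguous (A1 \<union> A2)"
    using A unfolding forests_on_def unambiguous_def by auto
  moreover have "corners B \<subseteq> corners S" "corners (S - B) \<subseteq> corners S"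
    using S(2) unfolding corners_def by blast+
  ultimately show "A1 \<union> A2 \<in> forests_on S"
    using A S(2) unfolding forests_on_def by blast
  show "splits (A1 \<union> A2) B"
    unfolding splits_def using c1 c2 d by (metis IntI UnE empty_iff)
  show "columns_of (A1 \<union> A2) B = A1" "columns_of (A1 \<union> A2) (S - B) = A2"
    unfolding columns_of_def using c1(1) c2(1) d(1) by blast+
qed

lemma trees_onD: "A \<in> trees_on S \<Longrightarrow> splits A B \<Longrightarrow> B \<subseteq> S \<Longrightarrow> B = {} \<or> B = S"
  unfolding trees_on_def by blast

lemma columns_of_Un:
  assumes "A \<in> forests_on S" "B \<subseteq> S"
  shows "columns_of A B \<union> columns_of A (S - B) = A"
  using forests_on_coords[OF assms(1)] unfolding columns_of_def by blast

text \<open>If two decompositions give the same forest, then \<open>B \<inter> B'\<close> splits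
  both trees and contains \<open>a\<close>; connectedness makes it equal to \<open>B\<close> and to
  \<open>B'\<close>.\<close>

lemma inj_on_forest_Un:
  assumes S: "general_position S"
  shows "inj_on (\<lambda>(B, A1, A2). A1 \<union> A2)
     (SIGMA B:{B. B \<subseteq> S \<and> a \<in> B}. trees_on B \<times> forests_on (S - B))"
proof (rule inj_onI, clarsimp)
  fix B A1 A2 B' A1' A2'
  assume B: "B \<subseteq> S" "a \<in> B" "B' \<subseteq> S" "a \<in> B'"
    and t: "A1 \<in> trees_on B" "A1' \<in> trees_on B'"
    and f: "A2 \<in> forests_on (S - B)" "A2' \<in> forests_on (S - B')"
    and eq: "A1 \<union> A2 = A1' \<union> A2'"
  have t': "A1 \<in> forests_on B" "A1' \<in> forests_on B'" using t by (auto simp: trees_on_def)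
  note F = forests_on_Un[OF S B(1) t'(1) f(1)]
  note F' = forests_on_Un[OF S B(3) t'(2) f(2), folded eq]
  have sp: "splits (A1 \<union> A2) (B \<inter> B')"
    by (rule splits_Int[OF S B(1,3) F(2) F'(2)])
  have "splits A1 (B \<inter> B')" using sp by (rule splits_subset) auto
  then have 1: "B \<inter> B' = B" using t(1) B unfolding trees_on_def by blast
  have "splits A1' (B \<inter> B')" using sp unfolding eq by (rule splits_subset) auto
  then have "B \<inter> B' = B'" using t(2) B unfolding trees_on_def by blast
  with 1 have "B = B'" by simp
  then show "B = B' \<and> A1 = A1' \<and> A2 = A2'" using F F' by metis
qed

text \<open>\<open>B\<close> is a splitting set of least cardinality containing \<open>a\<close>. If
  \<open>C\<close> splits it further, then \<open>C\<close> or \<open>B - C\<close> contains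
  \<open>a\<close>, and minimality forces that one to be all of \<open>B\<close>.\<close>

lemma forest_component:
  assumes S: "general_position S" "a \<in> S" and A: "A \<in> forests_on S"
  obtains B where "B \<subseteq> S" "a \<in> B" "splits A B" "columns_of A B \<in> trees_on B"
proof -
  let ?P = "\<lambda>B. B \<subseteq> S \<and> a \<in> B \<and> splits A B"
  have "?P S" using S splits_self[OF A] by simp
  then obtain B where B: "?P B" and min: "\<And>C. ?P C \<Longrightarrow> card B \<le> card C"
    using ex_has_least_nat[of ?P S card] by blast
  have fin: "finite B" using S B unfolding general_position_def by (meson finite_subset)
  have "C = {} \<or> C = B" if C: "C \<subseteq> B" "splits (columns_of A B) C" for C
  proof -
    have sC: "splits A C" using splits_columns_of B C by blast
    show ?thesis
    proof (cases "a \<in> C")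
      case True
      then have "card B \<le> card C" using min sC C B by blast
      then show ?thesis using C fin by (simp add: card_seteq)
    next
      case False
      have "splits A (B - C)" using splits_Diff[OF S(1)] B C sC by blast
      then have "card B \<le> card (B - C)" using min[of "B - C"] B False by auto
      then have "B - C = B" using fin by (intro card_seteq) auto
      then show ?thesis using C by blast
    qed
  qed
  then have "columns_of A B \<in> trees_on B"
    using columns_of_in_forests_on[OF S(1) A] B unfolding trees_on_def by blast
  then show ?thesis using that B by blast
qed

text \<open>The counterpart of \<open>card_words_rec\<close>: the tree containing the leaf
  \<open>a\<close> is split off, and an arbitrary forest on the other leaves remains.\<close>

lemma card_forests_on_rec:
  assumes S: "general_position S" and a: "a \<in> S"
  shows "card (forests_on S) =
    (\<Sum>B\<in>{B. B \<subseteq> S \<and> a \<in> B}. card (trees_on B) * card (forests_on (S - B)))"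
proof -
  let ?D = "SIGMA B:{B. B \<subseteq> S \<and> a \<in> B}. trees_on B \<times> forests_on (S - B)"
  have fin: "finite S" using S by (simp add: general_position_def)
  have "(\<lambda>(B, A1, A2). A1 \<union> A2) ` ?D = forests_on S"
  proof (intro equalityI subsetI)
    fix A assume "A \<in> (\<lambda>(B, A1, A2). A1 \<union> A2) ` ?D"
    then show "A \<in> forests_on S" using forests_on_Un(1)[OF S] by (auto simp: trees_on_def)
  next
    fix A assume A: "A \<in> forests_on S"
    obtain B where B: "B \<subseteq> S" "a \<in> B" "splits A B" "columns_of A B \<in> trees_on B"
      by (rule forest_component[OF S a A])
    have "splits A (S - B)" using splits_Diff[OF S] splits_self[OF A] B by blast
    then have "columns_of A (S - B) \<in> forests_on (S - B)"
      using columns_of_in_forests_on[OF S A] by blast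
    then show "A \<in> (\<lambda>(B, A1, A2). A1 \<union> A2) ` ?D"
      using B columns_of_Un[OF A B(1)]
      by (intro image_eqI[of _ _ "(B, columns_of A B, columns_of A (S - B))"]) auto
  qed
  then have "card (forests_on S) = card ?D"
    using card_image[OF inj_on_forest_Un[OF S, of a]] by simp
  also have "\<dots> = (\<Sum>B\<in>{B. B \<subseteq> S \<and> a \<in> B}. card (trees_on B) * card (forests_on (S - B)))"
    using fin by (intro card_Sigma_times)
      (auto intro: finite_forests_on finite_trees_on finite_subset)
  finally show ?thesis .
qed

section \<open>Roots of trees\<close>

text \<open>The intended \<open>\<rho>\<close> sends a point to the root of its tree; adding points in the order of increasing
  coordinate sum, a new point has a predecessor in its column or in its row, but not in both.\<close>

lemma root_function_exists:
  assumes "finite A" "unambiguous A"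
  shows "\<exists>\<rho>. (\<forall>p\<in>A. \<rho> p \<in> A \<and> fst (\<rho> p) \<le> fst p \<and> snd (\<rho> p) \<le> snd p) \<and>
    (\<forall>p\<in>A. \<forall>q\<in>A. fst p = fst q \<or> snd p = snd q \<longrightarrow> \<rho> p = \<rho> q)"
  using assms
proof (induction A rule: finite_ranking_induct[where f = "\<lambda>p. fst p + snd p"])
  case empty
  then show ?case by simp
next
  case (insert p A)
  have "unambiguous A" using insert.prems by (rule unambiguous_subset) auto
  then obtain \<rho> where r: "\<forall>q\<in>A. \<rho> q \<in> A \<and> fst (\<rho> q) \<le> fst q \<and> snd (\<rho> q) \<le> snd q"
    and c: "\<forall>q\<in>A. \<forall>s\<in>A. fst q = fst s \<or> snd q = snd s \<longrightarrow> \<rho> q = \<rho> s"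
    using insert.IH by blast
  show ?case
  proof (cases "p \<in> A")
    case True
    show ?thesis unfolding insert_absorb[OF True] using r c by blast
  next
    case False
    have col: "snd q < snd p" if "q \<in> A" "fst q = fst p" for q
    proof -
      have "snd q \<noteq> snd p" using that False prod_eqI[of q p] by auto
      then show ?thesis using insert.hyps(2)[OF that(1)] that(2) by linarith
    qed
    have row: "fst q < fst p" if "q \<in> A" "snd q = snd p" for q
    proof -
      have "fst q \<noteq> fst p" using that False prod_eqI[of q p] by auto
      then show ?thesis using insert.hyps(2)[OF that(1)] that(2) by linarith
    qed
    have amb: "\<not> (\<exists>q\<in>A. \<exists>s\<in>A. fst q = fst p \<and> snd s = snd p)"
      using insert.prems col row unfolding unambiguous_def below_def leftward_def by blast
    show ?thesis
    proof (cases "\<exists>q\<in>A. fst q = fst p \<or> snd q = snd p")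
      case True
      then obtain q where q: "q \<in> A" "fst q = fst p \<or> snd q = snd p" by blast
      then have le: "fst q \<le> fst p" "snd q \<le> snd p" using col[OF q(1)] row[OF q(1)] by auto
      have same: "\<rho> s = \<rho> q" if "s \<in> A" "fst s = fst p \<or> snd s = snd p" for s
        using that q amb c by metis
      have "\<rho> q \<in> A" "fst (\<rho> q) \<le> fst p" "snd (\<rho> q) \<le> snd p"
        using r q le by (meson order_trans)+
      then have "\<forall>s\<in>insert p A. (\<rho>(p := \<rho> q)) s \<in> insert p A \<and>
          fst ((\<rho>(p := \<rho> q)) s) \<le> fst s \<and> snd ((\<rho>(p := \<rho> q)) s) \<le> snd s"
        using r by auto
      moreover have "(\<rho>(p := \<rho> q)) s = (\<rho>(p := \<rho> q)) t"
        if "s \<in> insert p A" "t \<in> insert p A" "fst s = fst t \<or> snd s = snd t" for s t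
      proof (cases "s = p \<or> t = p")
        case True
        then show ?thesis using same[of s] same[of t] that by auto
      next
        case neither: False
        then have "s \<in> A" "t \<in> A" using that by auto
        then have "\<rho> s = \<rho> t" using c that(3) by blast
        then show ?thesis using neither by simp
      qed
      ultimately show ?thesis by blast
    next
      case none: False
      have "\<forall>s\<in>insert p A. (\<rho>(p := p)) s \<in> insert p A \<and>
          fst ((\<rho>(p := p)) s) \<le> fst s \<and> snd ((\<rho>(p := p)) s) \<le> snd s"
        using r by auto
      moreover have "(\<rho>(p := p)) s = (\<rho>(p := p)) t"
        if "s \<in> insert p A" "t \<in> insert p A" "fst s = fst t \<or> snd s = snd t" for s t
      proof (cases "s = p \<or> t = p")
        case True
        then show ?thesis using none that by auto
      next
        case neither: False
        then have "s \<in> A" "t \<in> A" using that by auto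
        then have "\<rho> s = \<rho> t" using c that(3) by blast
        then show ?thesis using neither by simp
      qed
      ultimately show ?thesis by blast
    qed
  qed
qed


text \<open>Each point of \<open>A\<close> shares its column with a leaf and its row with a leaf,
  and \<open>\<rho>\<close> takes the same value at both leaves as at the point itself. So either
  coordinate alone tells whether the point belongs to the fibre.\<close>

lemma splits_fibre:
  assumes A: "A \<in> forests_on S"
    and c: "\<forall>p\<in>A. \<forall>q\<in>A. fst p = fst q \<or> snd p = snd q \<longrightarrow> \<rho> p = \<rho> q"
  shows "splits A {p \<in> S. \<rho> p = r}"
proof -
  have SA: "S \<subseteq> A" using A by (simp add: forests_on_def)
  have "fst p \<in> fst ` {q \<in> S. \<rho> q = r} \<longleftrightarrow> \<rho> p = r"
    "snd p \<in> snd ` {q \<in> S. \<rho> q = r} \<longleftrightarrow> \<rho> p = r" if p: "p \<in> A" for p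
  proof -
    obtain u v where u: "u \<in> S" "fst p = fst u" and v: "v \<in> S" "snd p = snd v"
      using forests_on_coords[OF A p] by auto
    show "fst p \<in> fst ` {q \<in> S. \<rho> q = r} \<longleftrightarrow> \<rho> p = r"
      using u c p SA by (smt (verit, best) image_iff mem_Collect_eq subsetD)
    show "snd p \<in> snd ` {q \<in> S. \<rho> q = r} \<longleftrightarrow> \<rho> p = r"
      using v c p SA by (smt (verit, best) image_iff mem_Collect_eq subsetD)
  qed
  then show ?thesis unfolding splits_def by blast
qed

text \<open>Nothing lies to the left of column \<open>x\<close> or below row \<open>y\<close>. A
  point in this column or row therefore keeps one of its two sets empty, and all other points do not
  see the new one.\<close>

lemma unambiguous_insert_corner:
  assumes "unambiguous A" "\<forall>p\<in>A. x \<le> fst p \<and> y \<le> snd p"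
  shows "unambiguous (insert (x, y) A)"
proof -
  have "below (insert (x, y) A) p = {} \<or> leftward (insert (x, y) A) p = {}"
    if p: "p \<in> insert (x, y) A" for p
  proof (cases "fst p = x \<or> snd p = y")
    case True
    then show ?thesis using assms(2) p unfolding below_def leftward_def by fastforce
  next
    case False
    then have "p \<in> A" using p by auto
    moreover have "below (insert (x, y) A) p = below A p" "leftward (insert (x, y) A) p = leftward A p"
      using False unfolding below_def leftward_def by auto
    ultimately show ?thesis using assms(1) unfolding unambiguous_def by simp
  qed
  then show ?thesis unfolding unambiguous_def by blast
qed

section \<open>Inserting and removing the root of a tree\<close>

text \<open>Whether \<open>l\<close> and \<open>m\<close> coincide separates the base case from the
  recursion.\<close>

locale extremal_leaves =
  fixes S :: "point set" and l m :: point
  assumes gp: "general_position S" and l: "l \<in> S" and m: "m \<in> S"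
    and l_min: "\<forall>p\<in>S. fst l \<le> fst p" and m_min: "\<forall>p\<in>S. snd m \<le> snd p"
begin

lemma finite_S: "finite S"
  using gp by (simp add: general_position_def)

lemma root_le:
  assumes "A \<in> forests_on S" "p \<in> A"
  shows "fst l \<le> fst p" "snd m \<le> snd p"
  using forests_on_coords[OF assms] l_min m_min by auto

text \<open>A fibre of \<open>\<rho>\<close> splits the tree, so \<open>\<rho>\<close> is constant
  on the leaves. The common value lies weakly to the left of \<open>l\<close> and weakly below
  \<open>m\<close>, and no point of the tree lies further left or lower.\<close>

lemma root_in_tree:
  assumes A: "A \<in> trees_on S"
  shows "(fst l, snd m) \<in> A"
proof -
  have F: "A \<in> forests_on S" using A by (simp add: trees_on_def)
  have SA: "S \<subseteq> A" and una: "unambiguous A" using F by (auto simp: forests_on_def)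
  have "finite A"
    using F finite_subset[of A "S \<union> corners S"] finite_S finite_corners by (simp add: forests_on_def)
  then obtain \<rho> where r: "\<forall>p\<in>A. \<rho> p \<in> A \<and> fst (\<rho> p) \<le> fst p \<and> snd (\<rho> p) \<le> snd p"
    and c: "\<forall>p\<in>A. \<forall>q\<in>A. fst p = fst q \<or> snd p = snd q \<longrightarrow> \<rho> p = \<rho> q"
    using root_function_exists[OF _ una] by blast
  define B where "B = {p \<in> S. \<rho> p = \<rho> l}"
  have "splits A B" unfolding B_def by (rule splits_fibre[OF F c])
  moreover have "B \<subseteq> S" "l \<in> B" using l by (auto simp: B_def)
  ultimately have "B = S" using A unfolding trees_on_def by blast
  then have "\<rho> m = \<rho> l" using m by (auto simp: B_def)
  then have "\<rho> l \<in> A" "fst (\<rho> l) \<le> fst l" "snd (\<rho> l) \<le> snd m"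
    using r l m SA by (metis subsetD)+
  then have "\<rho> l = (fst l, snd m)"
    using root_le[OF F, of "\<rho> l"] by (simp add: prod_eq_iff)
  then show ?thesis using \<open>\<rho> l \<in> A\<close> by simp
qed

text \<open>A leaf that is both leftmost and lowest is neither of the two leaves of a corner, so it
  is alone in its column and row. Then \<open>{l}\<close> splits \<open>A\<close>, and connectedness
  gives the claim.\<close>

lemma tree_with_single_extremal_leaf:
  assumes "l = m" "A \<in> trees_on S"
  shows "S = {l}"
proof -
  have F: "A \<in> forests_on S" using assms by (simp add: trees_on_def)
  have "p = l" if pA: "p \<in> A" "fst p = fst l \<or> snd p = snd l" for p
  proof (cases "p \<in> S")
    case True
    then show ?thesis using pA gp l unfolding general_position_def by (meson inj_onD)
  next
    case False
    then obtain u v where "p = (fst u, snd v)" "u \<in> S" "v \<in> S" "fst u < fst v" "snd v < snd u"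
      using F pA(1) unfolding forests_on_def corners_def by blast
    moreover have "u \<noteq> l" "v \<noteq> l"
      using calculation l_min m_min assms(1) by (auto simp: leD)
    ultimately show ?thesis
      using pA gp l unfolding general_position_def by (metis fst_conv inj_onD snd_conv)
  qed
  then have "splits A {l}" unfolding splits_def by auto
  then show ?thesis using assms(2) l unfolding trees_on_def by blast
qed

text \<open>The new point lies in the column of \<open>l\<close> and in the row of \<open>m\<close>.
  A set \<open>C\<close> that splits the result contains both leaves or neither, and it contains
  each of \<open>B\<close> and \<open>S - B\<close> entirely or not at all.\<close>

lemma insert_root_in_trees_on:
  assumes "l \<noteq> m" and B: "B \<subseteq> S" "m \<in> B" "l \<notin> B"
    and t: "A1 \<in> trees_on B" "A2 \<in> trees_on (S - B)"
  shows "insert (fst l, snd m) (A1 \<union> A2) \<in> trees_on S"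
proof -
  let ?A = "insert (fst l, snd m) (A1 \<union> A2)"
  have f: "A1 \<in> forests_on B" "A2 \<in> forests_on (S - B)" using t by (auto simp: trees_on_def)
  note F = forests_on_Un(1)[OF gp B(1) f]
  have "unambiguous ?A"
    using F root_le[OF F] by (intro unambiguous_insert_corner) (auto simp: forests_on_def)
  moreover have "fst l \<noteq> fst m" "snd l \<noteq> snd m"
    using gp l m \<open>l \<noteq> m\<close> unfolding general_position_def inj_on_def by blast+
  then have "fst l < fst m" "snd m < snd l"
    using l m l_min m_min by (metis le_neq_implies_less)+
  then have "(fst l, snd m) \<in> corners S"
    using l m unfolding corners_def by blast
  ultimately have "?A \<in> forests_on S" using F by (auto simp: forests_on_def)
  moreover have "\<forall>C\<subseteq>S. splits ?A C \<longrightarrow> C = {} \<or> C = S"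
  proof (intro allI impI)
    fix C assume C: "C \<subseteq> S" "splits ?A C"
    have lm: "l \<in> C \<longleftrightarrow> m \<in> C"
      using C(2) general_position_fst_image_iff[OF gp C(1) l] general_position_snd_image_iff[OF gp C(1) m]
      unfolding splits_def by simp
    have "splits A1 C" "splits A2 C" using C(2) by (auto intro: splits_subset)
    then have "splits A1 (C \<inter> B)" "splits A2 (C \<inter> (S - B))"
      using splits_Int[OF gp C(1)] splits_self[OF f(1)] splits_self[OF f(2)] B(1) by blast+
    then have "C \<inter> B = {} \<or> C \<inter> B = B" "C \<inter> (S - B) = {} \<or> C \<inter> (S - B) = S - B"
      by (auto dest!: trees_onD[OF t(1)] trees_onD[OF t(2)])
    then show "C = {} \<or> C = S" using lm B l C(1) by blast
  qed
  ultimately show ?thesis unfolding trees_on_def by simp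
qed

lemma root_notin_leaves:
  assumes "l \<noteq> m"
  shows "(fst l, snd m) \<notin> S"
proof
  assume r: "(fst l, snd m) \<in> S"
  have "(fst l, snd m) = l" "(fst l, snd m) = m"
    using gp l m r unfolding general_position_def by (metis fst_conv inj_onD snd_conv)+
  then show False using assms by simp
qed

text \<open>Without its root the tree falls into exactly two trees. There are at least two, because
  a common value of \<open>\<rho>\<close> at \<open>l\<close> and \<open>m\<close> would be the
  deleted root; there are at most two, because a nonempty splitting set avoiding both leaves would
  already split \<open>A\<close>.\<close>

lemma tree_remove_root:
  assumes lm: "l \<noteq> m" and A: "A \<in> trees_on S"
  obtains B A1 A2 where "B \<subseteq> S" "m \<in> B" "l \<notin> B" "A1 \<in> trees_on B" "A2 \<in> trees_on (S - B)"
    "A = insert (fst l, snd m) (A1 \<union> A2)"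
proof -
  let ?r = "(fst l, snd m)"
  define A' where "A' = A - {?r}"
  have "A \<in> forests_on S" using A by (simp add: trees_on_def)
  then have F: "A' \<in> forests_on S"
    using root_notin_leaves[OF lm] unambiguous_subset[of A A'] by (auto simp: forests_on_def A'_def)
  have SA: "S \<subseteq> A'" and una: "unambiguous A'" using F by (auto simp: forests_on_def)
  have "finite A'"
    using F finite_subset[of A' "S \<union> corners S"] finite_S finite_corners by (simp add: forests_on_def)
  then obtain \<rho> where r: "\<forall>p\<in>A'. \<rho> p \<in> A' \<and> fst (\<rho> p) \<le> fst p \<and> snd (\<rho> p) \<le> snd p"
    and c: "\<forall>p\<in>A'. \<forall>q\<in>A'. fst p = fst q \<or> snd p = snd q \<longrightarrow> \<rho> p = \<rho> q"
    using root_function_exists[OF _ una] by blast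
  define B where "B = {p \<in> S. \<rho> p = \<rho> m}"
  have BS: "B \<subseteq> S" "m \<in> B" using m by (auto simp: B_def)
  have "\<rho> l \<noteq> \<rho> m"
  proof
    assume eq: "\<rho> l = \<rho> m"
    then have "\<rho> l \<in> A'" "fst (\<rho> l) \<le> fst l" "snd (\<rho> l) \<le> snd m"
      using r l m SA by (metis subsetD)+
    then have "\<rho> l = ?r" using root_le[OF F, of "\<rho> l"] by (simp add: prod_eq_iff)
    then show False using \<open>\<rho> l \<in> A'\<close> by (simp add: A'_def)
  qed
  then have lB: "l \<notin> B" by (simp add: B_def)
  have sB: "splits A' B" unfolding B_def by (rule splits_fibre[OF F c])
  then have sB': "splits A' (S - B)" using splits_Diff[OF gp] splits_self[OF F] BS by blast
  \<comment> \<open>If \<open>C\<close> contains neither leaf, then the root has neither its column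
    nor its row in \<open>C\<close>, so restoring it preserves the splitting.\<close>
  have empty: "C = {}" if C: "C \<subseteq> S" "splits A' C" "l \<notin> C" "m \<notin> C" for C
  proof -
    have "fst l \<notin> fst ` C" "snd m \<notin> snd ` C"
      using general_position_fst_image_iff[OF gp C(1) l] general_position_snd_image_iff[OF gp C(1) m] C
      by auto
    then have "splits A C"
      using C(2) unfolding splits_def A'_def by (metis Diff_iff fst_conv singletonD snd_conv)
    then show ?thesis using A C l unfolding trees_on_def by blast
  qed
  \<comment> \<open>As \<open>D\<close> contains exactly one of the two leaves, one of
    \<open>C\<close> and \<open>D - C\<close> avoids both and is empty.\<close>
  have connected: "columns_of A' D \<in> trees_on D"
    if D: "D \<subseteq> S" "splits A' D" "l \<in> D \<longleftrightarrow> m \<notin> D" for D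
  proof -
    have "C = {} \<or> C = D" if C: "C \<subseteq> D" "splits (columns_of A' D) C" for C
    proof -
      have sC: "splits A' C" using splits_columns_of D C by blast
      have sDC: "splits A' (D - C)" using splits_Diff[OF gp] D C sC by blast
      show ?thesis
      proof (cases "l \<in> C \<or> m \<in> C")
        case True
        then have "D - C = {}" using D C by (intro empty[OF _ sDC]) auto
        then show ?thesis using C by blast
      next
        case False
        then show ?thesis using empty[OF _ sC] D C by blast
      qed
    qed
    then show ?thesis
      using columns_of_in_forests_on[OF gp F D(1,2)] unfolding trees_on_def by blast
  qed
  show ?thesis
  proof
    show "B \<subseteq> S" "m \<in> B" "l \<notin> B" by (fact BS lB)+
    show "columns_of A' B \<in> trees_on B" "columns_of A' (S - B) \<in> trees_on (S - B)"
      using connected sB sB' BS lB l by blast+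
    show "A = insert ?r (columns_of A' B \<union> columns_of A' (S - B))"
      using columns_of_Un[OF F BS(1)] root_in_tree[OF A] by (auto simp: A'_def)
  qed
qed

lemma card_trees_on_rec:
  assumes lm: "l \<noteq> m"
  shows "card (trees_on S) =
    (\<Sum>B\<in>{B. B \<subseteq> S \<and> m \<in> B \<and> l \<notin> B}. card (trees_on B) * card (trees_on (S - B)))"
proof -
  let ?r = "(fst l, snd m)"
  let ?D = "SIGMA B:{B. B \<subseteq> S \<and> m \<in> B \<and> l \<notin> B}. trees_on B \<times> trees_on (S - B)"
  have "(\<lambda>(B, A1, A2). insert ?r (A1 \<union> A2)) ` ?D = trees_on S"
  proof (intro equalityI subsetI)
    fix A assume "A \<in> (\<lambda>(B, A1, A2). insert ?r (A1 \<union> A2)) ` ?D"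
    then show "A \<in> trees_on S" using insert_root_in_trees_on[OF lm] by auto
  next
    fix A assume A: "A \<in> trees_on S"
    obtain B A1 A2 where "B \<subseteq> S" "m \<in> B" "l \<notin> B" "A1 \<in> trees_on B" "A2 \<in> trees_on (S - B)"
      "A = insert ?r (A1 \<union> A2)"
      by (rule tree_remove_root[OF lm A])
    then show "A \<in> (\<lambda>(B, A1, A2). insert ?r (A1 \<union> A2)) ` ?D"
      by (intro image_eqI[of _ _ "(B, A1, A2)"]) auto
  qed
  moreover have "inj_on (\<lambda>(B, A1, A2). insert ?r (A1 \<union> A2)) ?D"
  proof -
    have sub: "?D \<subseteq> (SIGMA B:{B. B \<subseteq> S \<and> m \<in> B}. trees_on B \<times> forests_on (S - B))"
      by (auto simp: trees_on_def)
    \<comment> \<open>The column of the root belongs to \<open>l\<close>, a leaf outside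
      \<open>B\<close>, and its row to \<open>m\<close>, a leaf in \<open>B\<close>. So the root is
      in neither part, and the union is recovered by deleting it.\<close>
    have notin: "?r \<notin> A1 \<union> A2" if "(B, A1, A2) \<in> ?D" for B A1 A2
    proof
      have B: "B \<subseteq> S" "m \<in> B" "l \<notin> B" and f: "A1 \<in> forests_on B" "A2 \<in> forests_on (S - B)"
        using that by (auto simp: trees_on_def)
      assume "?r \<in> A1 \<union> A2"
      then have "fst l \<in> fst ` B \<or> snd m \<in> snd ` (S - B)"
        using forests_on_coords[OF f(1), of ?r] forests_on_coords[OF f(2), of ?r] by auto
      then show False
        using general_position_fst_image_iff[OF gp B(1) l]
          general_position_snd_image_iff[OF gp _ m, of "S - B"] B by auto
    qed
    show ?thesis
    proof (rule inj_onI)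
      fix z z' assume z: "z \<in> ?D" "z' \<in> ?D"
        and eq: "(\<lambda>(B, A1, A2). insert ?r (A1 \<union> A2)) z = (\<lambda>(B, A1, A2). insert ?r (A1 \<union> A2)) z'"
      obtain B A1 A2 B' A1' A2' where zz: "z = (B, A1, A2)" "z' = (B', A1', A2')"
        by (metis prod_cases3)
      have "A1 \<union> A2 = A1' \<union> A2'"
        using eq insert_ident[OF notin[OF z(1)[unfolded zz]] notin[OF z(2)[unfolded zz]]]
        unfolding zz prod.case by (rule iffD1[rotated])
      then show "z = z'"
        by (intro inj_onD[OF inj_on_subset[OF inj_on_forest_Un[OF gp, of m] sub] _ z]) (simp add: zz)
    qed
  qed
  ultimately have "card (trees_on S) = card ?D"
    using card_image by fastforce
  also have "\<dots> = (\<Sum>B\<in>{B. B \<subseteq> S \<and> m \<in> B \<and> l \<notin> B}. card (trees_on B) * card (trees_on (S - B)))"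
    using finite_S by (intro card_Sigma_times) (auto intro: finite_trees_on finite_subset)
  finally show ?thesis .
qed

end

section \<open>Equality of the counts\<close>

lemma extremal_leaves_exist:
  assumes "general_position S" "S \<noteq> {}"
  shows "\<exists>l\<in>S. \<forall>p\<in>S. fst l \<le> fst p" "\<exists>m\<in>S. \<forall>p\<in>S. snd m \<le> snd p"
  using assms ex_min_if_finite[of "fst ` S"] ex_min_if_finite[of "snd ` S"]
  unfolding general_position_def by (auto simp: not_less)

lemma trees_on_singleton: "trees_on {p} = {{p}}"
proof -
  have "corners {p} = {}" by (auto simp: corners_def)
  moreover have "unambiguous {p}" by (auto simp: unambiguous_def below_def)
  ultimately show ?thesis by (auto simp: trees_on_def forests_on_def)
qed

lemma words_from_singleton: "words_from p {p} = {[p]}"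
proof -
  have "w = [p]" if "distinct w" "set w = {p}" for w
    using that by (cases w; cases "tl w") auto
  then show ?thesis by (auto simp: words_from_def words_def)
qed

context extremal_leaves
begin

text \<open>A second point of the word would be reached from \<open>l\<close> by a step that
  increases both coordinates.\<close>

lemma words_from_single_extremal_leaf:
  assumes "l = m" "w \<in> words_from l S"
  shows "S = {l}"
proof (rule ccontr)
  assume S: "S \<noteq> {l}"
  have w: "distinct w" "set w = S" "successively steep w" "w \<noteq> []" "hd w = l"
    using assms(2) by (auto simp: words_from_def words_def)
  then obtain q t where wq: "w = l # q # t"
    using S by (metis empty_set list.exhaust list.sel(1) list.simps(15))
  then have q: "q \<in> S" "q \<noteq> l" "steep l q" using w by auto
  then have "fst l \<noteq> fst q" "snd l \<noteq> snd q"
    using gp l unfolding general_position_def inj_on_def by blast+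
  moreover have "fst l \<le> fst q" "snd l \<le> snd q" using q l_min m_min assms(1) by auto
  ultimately show False using q unfolding steep_def by simp
qed

end

text \<open>Both equalities are proved together because the recursion at \<open>l\<close> calls the
  count starting at \<open>m\<close> on \<open>B\<close>, with a new leftmost point, and the count
  starting at \<open>l\<close> on \<open>S - B\<close>, with a new lowest point.\<close>

lemma card_words_from_eq_card_trees_on:
  assumes "extremal_leaves S l m"
  shows "card (words_from l S) = card (trees_on S) \<and> card (words_from m S) = card (trees_on S)"
  using assms
proof (induction "card S" arbitrary: S l m rule: less_induct)
  case less
  interpret extremal_leaves S l m by fact
  show ?case
  proof (cases "l = m")
    case True
    show ?thesis
    proof (cases "S = {l}")
      case True
      then show ?thesis using \<open>l = m\<close> by (simp add: trees_on_singleton words_from_singleton)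
    next
      case False
      then have "trees_on S = {}" "words_from l S = {}"
        using \<open>l = m\<close> tree_with_single_extremal_leaf words_from_single_extremal_leaf by blast+
      then show ?thesis using \<open>l = m\<close> by simp
    qed
  next
    case False
    let ?I = "{B. B \<subseteq> S \<and> m \<in> B \<and> l \<notin> B}"
    have steep: "\<forall>p\<in>S. steep p l" "\<forall>p\<in>S. steep p m"
      using l_min m_min unfolding steep_def by (auto simp: not_less)
    have IH: "card (words_from m B) = card (trees_on B)"
      "card (words_from l (S - B)) = card (trees_on (S - B))" if "B \<in> ?I" for B
    proof -
      have B: "B \<subseteq> S" "m \<in> B" "l \<notin> B" using that by auto
      have g: "general_position B" "general_position (S - B)"
        using general_position_subset[OF gp] B by auto
      have "B \<subset> S" "S - B \<subset> S" using B l m by blast+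
      then have c: "card B < card S" "card (S - B) < card S"
        using finite_S by (auto intro: psubset_card_mono)
      obtain l' where "l' \<in> B" "\<forall>p\<in>B. fst l' \<le> fst p"
        using extremal_leaves_exist(1)[OF g(1)] B by blast
      then have "extremal_leaves B l' m"
        using g(1) B m_min by unfold_locales auto
      then show "card (words_from m B) = card (trees_on B)"
        using less.hyps[OF c(1)] by blast
      obtain m' where "m' \<in> S - B" "\<forall>p\<in>S - B. snd m' \<le> snd p"
        using extremal_leaves_exist(2)[OF g(2)] B l by blast
      then have "extremal_leaves (S - B) l m'"
        using g(2) B l l_min by unfold_locales auto
      then show "card (words_from l (S - B)) = card (trees_on (S - B))"
        using less.hyps[OF c(2)] by blast
    qed
    have "card (words_from l S) = (\<Sum>B\<in>?I. card (words_from m B) * card (words_from l (S - B)))"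
      by (rule card_words_from_rec[OF finite_S l m False steep(2)])
    moreover have "card (words_from m S) =
        (\<Sum>B\<in>{B. B \<subseteq> S \<and> l \<in> B \<and> m \<notin> B}. card (words_from l B) * card (words_from m (S - B)))"
      by (rule card_words_from_rec[OF finite_S m l _ steep(1)]) (use False in auto)
    \<comment> \<open>Replacing \<open>B\<close> by \<open>S - B\<close> exchanges the roles of
      \<open>l\<close> and \<open>m\<close> and of the two factors.\<close>
    moreover have "\<dots> = (\<Sum>B\<in>?I. card (words_from m B) * card (words_from l (S - B)))"
      using l m by (intro sum.reindex_bij_witness[where i = "\<lambda>B. S - B" and j = "\<lambda>B. S - B"])
        (auto simp: double_diff)
    moreover have "\<dots> = (\<Sum>B\<in>?I. card (trees_on B) * card (trees_on (S - B)))"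
      using IH by (intro sum.cong) auto
    moreover have "\<dots> = card (trees_on S)" by (rule card_trees_on_rec[OF False, symmetric])
    ultimately show ?thesis by simp
  qed
qed

text \<open>The induction hypothesis is applied to \<open>S - B\<close>, which lacks
  \<open>l\<close>. The factor for \<open>B\<close>, which may be all of \<open>S\<close>, is
  covered by \<open>card_words_from_eq_card_trees_on\<close>.\<close>

lemma card_words_eq_card_forests_on:
  assumes "general_position S"
  shows "card (words S) = card (forests_on S)"
  using assms
proof (induction "card S" arbitrary: S rule: less_induct)
  case less
  show ?case
  proof (cases "S = {}")
    case True
    have "words {} = {[]}" by (auto simp: words_def)
    moreover have "forests_on {} = {{}}" by (auto simp: forests_on_def corners_def unambiguous_def)
    ultimately show ?thesis using True by simp
  next
    case False
    have fin: "finite S" using less.prems by (simp add: general_position_def)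
    obtain l where l: "l \<in> S" "\<forall>p\<in>S. fst l \<le> fst p"
      using extremal_leaves_exist(1)[OF less.prems False] by blast
    then have steep: "\<forall>p\<in>S. steep p l" by (auto simp: steep_def not_less)
    have eq: "card (words_from l B) * card (words (S - B)) = card (trees_on B) * card (forests_on (S - B))"
      if "B \<in> {B. B \<subseteq> S \<and> l \<in> B}" for B
    proof -
      have B: "B \<subseteq> S" "l \<in> B" using that by auto
      have g: "general_position B" "general_position (S - B)"
        using general_position_subset[OF less.prems] B by auto
      have "S - B \<subset> S" using B by blast
      then have "card (words (S - B)) = card (forests_on (S - B))"
        using less.hyps[OF psubset_card_mono[OF fin] g(2)] by blast
      moreover obtain m where "m \<in> B" "\<forall>p\<in>B. snd m \<le> snd p"
        using extremal_leaves_exist(2)[OF g(1)] B by blast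
      then have "extremal_leaves B l m"
        using g(1) B l by unfold_locales auto
      then have "card (words_from l B) = card (trees_on B)"
        using card_words_from_eq_card_trees_on by blast
      ultimately show ?thesis by simp
    qed
    show ?thesis
      unfolding card_words_rec[OF fin l(1) steep] card_forests_on_rec[OF less.prems l(1)]
      using eq by (rule sum.cong[OF refl])
  qed
qed

section \<open>Children and leaves\<close>

definition above :: "point set \<Rightarrow> point \<Rightarrow> point set" where
  "above A p = {q \<in> A. fst q = fst p \<and> snd p < snd q}"

definition rightward :: "point set \<Rightarrow> point \<Rightarrow> point set" where
  "rightward A p = {q \<in> A. snd q = snd p \<and> fst p < fst q}"

text \<open>While \<open>parent\<close> looks down and to the left, this turns the view around: the
  children of \<open>p\<close> are the nearest point above it and the nearest point to its
  right.\<close>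

lemma parent_eq_Some_iff:
  assumes A: "finite A" "unambiguous A" and p: "p \<in> A" and q: "q \<in> A"
  shows "parent A q = Some p \<longleftrightarrow>
    (q \<in> above A p \<and> (\<forall>s\<in>above A p. snd q \<le> snd s)) \<or>
    (q \<in> rightward A p \<and> (\<forall>s\<in>rightward A p. fst q \<le> fst s))" (is "_ \<longleftrightarrow> ?U \<or> ?R")
proof
  have fin: "finite (snd ` below A q)" "finite (fst ` leftward A q)"
    using A(1) by (auto simp: below_def leftward_def)
  assume par: "parent A q = Some p"
  show "?U \<or> ?R"
  proof (cases "below A q = {}")
    case False
    then have pq: "fst p = fst q" "snd p = Max (snd ` below A q)"
      using par by (auto simp: parent_def)
    have "snd p \<in> snd ` below A q" unfolding pq(2) using fin(1) False by (intro Max_in) auto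
    then have "q \<in> above A p" using q pq(1) by (auto simp: above_def below_def)
    moreover have "snd q \<le> snd s" if s: "s \<in> above A p" for s
    proof (rule ccontr)
      assume "\<not> snd q \<le> snd s"
      then have "s \<in> below A q" using s pq(1) by (auto simp: above_def below_def)
      then have "snd s \<le> snd p" unfolding pq(2) using fin(1) by (intro Max_ge) auto
      then show False using s by (simp add: above_def)
    qed
    ultimately show ?thesis by blast
  next
    case True
    then have ne: "leftward A q \<noteq> {}" using par by (auto simp: parent_def split: if_splits)
    then have pq: "snd p = snd q" "fst p = Max (fst ` leftward A q)"
      using par True by (auto simp: parent_def)
    have "fst p \<in> fst ` leftward A q" unfolding pq(2) using fin(2) ne by (intro Max_in) auto
    then have "q \<in> rightward A p" using q pq(1) by (auto simp: rightward_def leftward_def)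
    moreover have "fst q \<le> fst s" if s: "s \<in> rightward A p" for s
    proof (rule ccontr)
      assume "\<not> fst q \<le> fst s"
      then have "s \<in> leftward A q" using s pq(1) by (auto simp: rightward_def leftward_def)
      then have "fst s \<le> fst p" unfolding pq(2) using fin(2) by (intro Max_ge) auto
      then show False using s by (simp add: rightward_def)
    qed
    ultimately show ?thesis by blast
  qed
next
  have fin: "finite (snd ` below A q)" "finite (fst ` leftward A q)"
    using A(1) by (auto simp: below_def leftward_def)
  assume "?U \<or> ?R"
  then show "parent A q = Some p"
  proof
    assume U: ?U
    then have pb: "p \<in> below A q" using p by (auto simp: above_def below_def)
    have "Max (snd ` below A q) = snd p"
    proof (rule Max_eqI[OF fin(1)])
      fix y assume "y \<in> snd ` below A q"
      then obtain s where s: "y = snd s" "s \<in> below A q" by blast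
      show "y \<le> snd p"
      proof (rule ccontr)
        assume "\<not> y \<le> snd p"
        then have "s \<in> above A p" using s U by (auto simp: above_def below_def)
        then show False using U s by (auto simp: below_def)
      qed
    qed (use pb in blast)
    moreover have "below A q \<noteq> {}" using pb by blast
    moreover have "fst q = fst p" using pb by (simp add: below_def)
    ultimately show ?thesis by (simp add: parent_def)
  next
    assume R: ?R
    then have pb: "p \<in> leftward A q" using p by (auto simp: rightward_def leftward_def)
    \<comment> \<open>A point to the left of \<open>q\<close> excludes any below it, so
      \<open>parent\<close> takes its second branch.\<close>
    then have nb: "below A q = {}" using A(2) q unfolding unambiguous_def by blast
    have "Max (fst ` leftward A q) = fst p"
    proof (rule Max_eqI[OF fin(2)])
      fix x assume "x \<in> fst ` leftward A q"
      then obtain s where s: "x = fst s" "s \<in> leftward A q" by blast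
      show "x \<le> fst p"
      proof (rule ccontr)
        assume "\<not> x \<le> fst p"
        then have "s \<in> rightward A p" using s R by (auto simp: rightward_def leftward_def)
        then show False using R s by (auto simp: leftward_def)
      qed
    qed (use pb in blast)
    moreover have "leftward A q \<noteq> {}" using pb by blast
    moreover have "snd q = snd p" using pb by (simp add: leftward_def)
    ultimately show ?thesis using nb by (simp add: parent_def)
  qed
qed

lemma card_minimizers:
  fixes f :: "'a \<Rightarrow> nat"
  assumes "finite X" "inj_on f X"
  shows "card {q \<in> X. \<forall>s\<in>X. f q \<le> f s} = (if X = {} then 0 else 1)"
proof (cases "X = {}")
  case False
  then obtain q where q: "q \<in> X" "\<forall>s\<in>X. f q \<le> f s"
    using assms(1) ex_min_if_finite[of "f ` X"] by (auto simp: not_less)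
  then have "{q \<in> X. \<forall>s\<in>X. f q \<le> f s} = {q}"
    using assms(2) by (auto dest: inj_onD intro: le_antisym)
  then show ?thesis using False by simp
qed simp

text \<open>The nearest point in each direction is unique if it exists, and the two are distinct. In
  a complete forest \<open>above\<close> and \<open>rightward\<close> are therefore empty
  simultaneously.\<close>

lemma card_children:
  assumes A: "finite A" "unambiguous A" and p: "p \<in> A"
  shows "card (children A p) = (if above A p = {} then 0 else 1) + (if rightward A p = {} then 0 else 1)"
proof -
  let ?U = "{q \<in> above A p. \<forall>s\<in>above A p. snd q \<le> snd s}"
  let ?R = "{q \<in> rightward A p. \<forall>s\<in>rightward A p. fst q \<le> fst s}"
  have sub: "above A p \<subseteq> A" "rightward A p \<subseteq> A" by (auto simp: above_def rightward_def)
  then have fin: "finite (above A p)" "finite (rightward A p)" using A(1) finite_subset by blast+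
  have "children A p = ?U \<union> ?R"
    using parent_eq_Some_iff[OF A p] sub unfolding children_def by blast
  moreover have "?U \<inter> ?R = {}" by (auto simp: above_def rightward_def)
  ultimately have "card (children A p) = card ?U + card ?R"
    using fin by (simp add: card_Un_disjoint)
  moreover have "inj_on snd (above A p)" "inj_on fst (rightward A p)"
    by (auto simp: above_def rightward_def inj_on_def)
  ultimately show ?thesis using card_minimizers[OF fin(1)] card_minimizers[OF fin(2)] by simp
qed

lemma leaf_iff:
  assumes A: "finite A" "unambiguous A" and p: "p \<in> A"
  shows "p \<in> leaves A \<longleftrightarrow> above A p = {} \<and> rightward A p = {}"
proof -
  have "p \<in> leaves A \<longleftrightarrow> card (children A p) = 0"
    using p A(1) by (simp add: leaves_def children_def)
  then show ?thesis unfolding card_children[OF assms] by auto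
qed

section \<open>Complete forests with a given set of leaves\<close>

lemma nonambiguous_forest_unambiguous: "nonambiguous_forest A \<Longrightarrow> finite A \<and> unambiguous A"
  unfolding nonambiguous_forest_def unambiguous_def by blast

lemma complete_forest_above_iff_rightward:
  assumes "complete_forest A" "p \<in> A"
  shows "above A p = {} \<longleftrightarrow> rightward A p = {}"
proof -
  have A: "finite A" "unambiguous A"
    using assms(1) nonambiguous_forest_unambiguous unfolding complete_forest_def by blast+
  have "card (children A p) = 0 \<or> card (children A p) = 2"
    using assms unfolding complete_forest_def by blast
  then show ?thesis unfolding card_children[OF A assms(2)] by (auto split: if_splits)
qed

text \<open>The topmost point of the column has nothing above it; by completeness it has nothing to
  its right either and is a leaf.\<close>

lemma complete_forest_leaf_in_column:
  assumes A: "complete_forest A" and p: "p \<in> A"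
  obtains u where "u \<in> leaves A" "fst u = fst p" "snd p \<le> snd u"
proof -
  have fu: "finite A" "unambiguous A"
    using A nonambiguous_forest_unambiguous unfolding complete_forest_def by blast+
  let ?X = "{q \<in> A. fst q = fst p \<and> snd p \<le> snd q}"
  have "p \<in> ?X" using p by simp
  then have "snd ` ?X \<noteq> {}" by blast
  moreover have "finite (snd ` ?X)" using fu by simp
  ultimately have "Max (snd ` ?X) \<in> snd ` ?X" by (intro Max_in)
  then obtain u where u: "u \<in> ?X" and max: "snd u = Max (snd ` ?X)" by auto
  have "\<not> snd u < snd q" if "q \<in> ?X" for q
    unfolding max not_less using that fu by (intro Max_ge) auto
  then have "above A u = {}" using u by (fastforce simp: above_def)
  then have "u \<in> leaves A"
    using leaf_iff[OF fu] complete_forest_above_iff_rightward[OF A] u by auto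
  then show ?thesis using that u by auto
qed

lemma complete_forest_leaf_in_row:
  assumes A: "complete_forest A" and p: "p \<in> A"
  obtains u where "u \<in> leaves A" "snd u = snd p" "fst p \<le> fst u"
proof -
  have fu: "finite A" "unambiguous A"
    using A nonambiguous_forest_unambiguous unfolding complete_forest_def by blast+
  let ?X = "{q \<in> A. snd q = snd p \<and> fst p \<le> fst q}"
  have "p \<in> ?X" using p by simp
  then have "fst ` ?X \<noteq> {}" by blast
  moreover have "finite (fst ` ?X)" using fu by simp
  ultimately have "Max (fst ` ?X) \<in> fst ` ?X" by (intro Max_in)
  then obtain u where u: "u \<in> ?X" and max: "fst u = Max (fst ` ?X)" by auto
  have "\<not> fst u < fst q" if "q \<in> ?X" for q
    unfolding max not_less using that fu by (intro Max_ge) auto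
  then have "rightward A u = {}" using u by (fastforce simp: rightward_def)
  then have "u \<in> leaves A"
    using leaf_iff[OF fu] complete_forest_above_iff_rightward[OF A] u by auto
  then show ?thesis using that u by auto
qed

lemma complete_forest_in_forests_on:
  assumes A: "complete_forest A"
  shows "A \<in> forests_on (leaves A)"
proof -
  have fu: "finite A" "unambiguous A"
    using A nonambiguous_forest_unambiguous unfolding complete_forest_def by blast+
  have "p \<in> corners (leaves A)" if p: "p \<in> A" "p \<notin> leaves A" for p
  proof -
    obtain u where u: "u \<in> leaves A" "fst u = fst p" "snd p \<le> snd u"
      by (rule complete_forest_leaf_in_column[OF A p(1)])
    obtain v where v: "v \<in> leaves A" "snd v = snd p" "fst p \<le> fst v"
      by (rule complete_forest_leaf_in_row[OF A p(1)])
    have "u \<noteq> p" "v \<noteq> p" using u v p by auto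
    then have "snd u \<noteq> snd p" "fst v \<noteq> fst p" using u v by (auto simp: prod_eq_iff)
    then have "snd v < snd u" "fst u < fst v" "p = (fst u, snd v)"
      using u v by (auto simp: prod_eq_iff)
    then show ?thesis using u(1) v(1) unfolding corners_def by blast
  qed
  moreover have "leaves A \<subseteq> A" by (auto simp: leaves_def)
  ultimately show ?thesis using fu(2) unfolding forests_on_def by blast
qed

lemma general_position_perm_points:
  assumes "\<eta> permutes {1..n}"
  shows "general_position (perm_points n \<eta>)"
    "fst ` perm_points n \<eta> = {1..n}" "snd ` perm_points n \<eta> = {1..n}"
proof -
  have P: "perm_points n \<eta> = (\<lambda>i. (i, \<eta> i)) ` {1..n}" by (auto simp: perm_points_def)
  show "general_position (perm_points n \<eta>)"
    using permutes_inj[OF assms] unfolding general_position_def P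
    by (auto simp: inj_on_def dest: injD)
  show "fst ` perm_points n \<eta> = {1..n}" unfolding P by (simp add: image_image)
  show "snd ` perm_points n \<eta> = {1..n}"
    unfolding P using permutes_image[OF assms] by (simp add: image_image)
qed

text \<open>A corner lies below its upper left leaf and to the left of its lower right leaf, so it
  has both children. The other points in the column of a point of \<open>S\<close> are corners below
  it, and those in its row are corners to its left.\<close>

lemma forests_on_leaves:
  assumes S: "general_position S" and A: "A \<in> forests_on S"
  shows "leaves A = S" "p \<in> A \<Longrightarrow> above A p = {} \<longleftrightarrow> rightward A p = {}" "finite A" "unambiguous A"
proof -
  have SA: "S \<subseteq> A" "A \<subseteq> S \<union> corners S" using A by (auto simp: forests_on_def)
  show una: "unambiguous A" using A by (auto simp: forests_on_def)
  show fin: "finite A"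
    using SA(2) S finite_corners finite_subset unfolding general_position_def by (metis finite_UnI)
  have leaf: "above A p = {}" "rightward A p = {}" if p: "p \<in> S" for p
  proof -
    have "\<not> (fst q = fst p \<and> snd p < snd q)" "\<not> (snd q = snd p \<and> fst p < fst q)" if q: "q \<in> A" for q
    proof -
      consider "q \<in> S" | u v where "q = (fst u, snd v)" "u \<in> S" "v \<in> S" "fst u < fst v" "snd v < snd u"
        using q SA(2) unfolding corners_def by blast
      then have "\<not> (fst q = fst p \<and> snd p < snd q) \<and> \<not> (snd q = snd p \<and> fst p < fst q)"
      proof cases
        case 1
        then show ?thesis using p S unfolding general_position_def by (metis inj_onD less_irrefl)
      next
        case 2
        then show ?thesis
          using p S unfolding general_position_def
          by (metis fst_conv inj_onD less_asym snd_conv)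
      qed
      then show "\<not> (fst q = fst p \<and> snd p < snd q)" "\<not> (snd q = snd p \<and> fst p < fst q)" by auto
    qed
    then show "above A p = {}" "rightward A p = {}" by (auto simp: above_def rightward_def)
  qed
  have corner: "above A p \<noteq> {}" "rightward A p \<noteq> {}" if p: "p \<in> corners S" for p
  proof -
    obtain u v where uv: "p = (fst u, snd v)" "u \<in> S" "v \<in> S" "fst u < fst v" "snd v < snd u"
      using p unfolding corners_def by blast
    have "u \<in> above A p" "v \<in> rightward A p" using uv SA by (auto simp: above_def rightward_def)
    then show "above A p \<noteq> {}" "rightward A p \<noteq> {}" by auto
  qed
  show "above A p = {} \<longleftrightarrow> rightward A p = {}" if "p \<in> A"
    using that leaf corner SA(2) by blast
  have "p \<in> leaves A \<longleftrightarrow> p \<in> S" if "p \<in> A" for p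
    using leaf_iff[OF fin una that] leaf[of p] corner[of p] that SA(2) by blast
  moreover have "leaves A \<subseteq> A" by (auto simp: leaves_def)
  ultimately show "leaves A = S" using SA(1) by blast
qed

text \<open>The leaves occupy every row and column in \<open>{1..n}\<close>, and corners only use
  those, so the condition that no row or column is skipped is automatic.\<close>

lemma forests_with_leaves_eq:
  assumes "\<eta> permutes {1..n}"
  shows "forests_with_leaves n \<eta> = forests_on (perm_points n \<eta>)"
proof (intro equalityI subsetI)
  fix A assume "A \<in> forests_with_leaves n \<eta>"
  then show "A \<in> forests_on (perm_points n \<eta>)"
    using complete_forest_in_forests_on unfolding forests_with_leaves_def by fastforce
next
  fix A assume A: "A \<in> forests_on (perm_points n \<eta>)"
  note P = general_position_perm_points[OF assms]
  note L = forests_on_leaves[OF P(1) A]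
  have PA: "perm_points n \<eta> \<subseteq> A" using A by (simp add: forests_on_def)
  have coords: "fst p \<in> {1..n}" "snd p \<in> {1..n}" if "p \<in> A" for p
    using forests_on_coords[OF A that] P by auto
  have "nonambiguous_forest A"
    unfolding nonambiguous_forest_def
  proof (intro conjI ballI allI impI)
    fix p x' assume "p \<in> A" "1 \<le> x' \<and> x' < fst p"
    then have "x' \<in> fst ` perm_points n \<eta>" using coords[of p] P by auto
    then show "\<exists>q\<in>A. fst q = x'" using PA by blast
  next
    fix p y' assume "p \<in> A" "1 \<le> y' \<and> y' < snd p"
    then have "y' \<in> snd ` perm_points n \<eta>" using coords[of p] P by auto
    then show "\<exists>q\<in>A. snd q = y'" using PA by blast
  next
    show "\<not> (\<exists>p\<in>A. (\<exists>q. q \<in> below A p) \<and> (\<exists>s. s \<in> leftward A p))"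
      using L(4) unfolding unambiguous_def by blast
  qed (use L(3) coords in auto)
  moreover have "card (children A p) = 0 \<or> card (children A p) = 2" if "p \<in> A" for p
    unfolding card_children[OF L(3,4) that] using L(2)[OF that] by simp
  ultimately show "A \<in> forests_with_leaves n \<eta>"
    using L(1) unfolding forests_with_leaves_def complete_forest_def by blast
qed

section \<open>Pairs of permutations as orderings\<close>

lemma bij_betw_pairs_words:
  assumes \<eta>: "\<eta> permutes {1..n}"
  shows "bij_betw (\<lambda>(a, b). map (\<lambda>i. (a i, b i)) [1..<Suc n])
    (no_common_rise_pairs n \<eta>) (words (perm_points n \<eta>))"
proof (rule bij_betwI')
  let ?f = "\<lambda>(a, b). map (\<lambda>i. (a i, b i)) [1..<Suc n] :: point list"
  have rise: "(\<nexists>i. common_rise_at n a b i) \<longleftrightarrow>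
    successively steep (map (\<lambda>i. (a i, b i)) [1..<Suc n])" for a b :: "nat \<Rightarrow> nat"
  proof -
    have "successively steep (map (\<lambda>i. (a i, b i)) [1..<Suc n]) \<longleftrightarrow>
      (\<forall>i. Suc i < n \<longrightarrow> steep (a (Suc i), b (Suc i)) (a (Suc (Suc i)), b (Suc (Suc i))))"
      by (simp add: successively_conv_nth del: upt_Suc)
    also have "\<dots> \<longleftrightarrow> (\<forall>i. \<not> common_rise_at n a b (Suc i))"
      by (auto simp: steep_def common_rise_at_def)
    \<comment> \<open>The shift between list positions, which start at \<open>0\<close>, and indices
      of permutations loses nothing, because a common rise requires
      \<open>1 \<le> i\<close>.\<close>
    also have "\<dots> \<longleftrightarrow> (\<nexists>i. common_rise_at n a b i)"
      unfolding common_rise_at_def by (metis Suc_le_D One_nat_def)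
    finally show ?thesis by blast
  qed
  have img: "{(a i, b i) | i. i \<in> {1..n}} = set (map (\<lambda>i. (a i, b i)) [1..<Suc n])"
    for a b :: "nat \<Rightarrow> nat"
    by (auto simp del: upt_Suc)
  fix z
  show "?f z \<in> words (perm_points n \<eta>)" if z: "z \<in> no_common_rise_pairs n \<eta>"
  proof -
    obtain a b where ab: "z = (a, b)" by fastforce
    have "inj a" using z permutes_inj unfolding ab no_common_rise_pairs_def by blast
    then have "distinct (map (\<lambda>i. (a i, b i)) [1..<Suc n])"
      by (auto simp: distinct_map inj_on_def dest: injD simp del: upt_Suc)
    then show ?thesis
      using z unfolding ab no_common_rise_pairs_def words_def img rise by simp
  qed
  fix z'
  show "?f z = ?f z' \<longleftrightarrow> z = z'"
    if z: "z \<in> no_common_rise_pairs n \<eta>" "z' \<in> no_common_rise_pairs n \<eta>"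
  proof
    assume eq: "?f z = ?f z'"
    obtain a b a' b' where ab: "z = (a, b)" "z' = (a', b')" by fastforce
    have p: "a permutes {1..n}" "b permutes {1..n}" "a' permutes {1..n}" "b' permutes {1..n}"
      using z unfolding ab no_common_rise_pairs_def by auto
    have "a i = a' i \<and> b i = b' i" for i
    proof (cases "i \<in> {1..n}")
      case True
      then show ?thesis using eq unfolding ab by (auto simp del: upt_Suc)
    next
      case False
      then show ?thesis using p by (simp add: permutes_not_in)
    qed
    then show "z = z'" unfolding ab by auto
  qed simp
next
  note P = general_position_perm_points[OF \<eta>]
  fix w assume w: "w \<in> words (perm_points n \<eta>)"
  have "card (perm_points n \<eta>) = n"
    using P card_image[of fst "perm_points n \<eta>"] by (simp add: general_position_def)
  then have len: "length w = n" using w distinct_card[of w] by (simp add: words_def)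
  \<comment> \<open>The word fixes both maps on \<open>{1..n}\<close>; outside they must be the
    identity for \<open>permutes\<close> to hold.\<close>
  define a where "a i = (if i \<in> {1..n} then fst (w ! (i - 1)) else i)" for i
  define b where "b i = (if i \<in> {1..n} then snd (w ! (i - 1)) else i)" for i
  have wab: "map (\<lambda>i. (a i, b i)) [1..<Suc n] = w"
    using len by (intro nth_equalityI) (auto simp: a_def b_def simp del: upt_Suc)
  have permI: "c permutes {1..n}" if "c ` {1..n} = {1..n}" "\<forall>i. i \<notin> {1..n} \<longrightarrow> c i = i"
    for c :: "nat \<Rightarrow> nat"
    using that by (intro bij_imp_permutes) (auto simp: bij_betw_def eq_card_imp_inj_on)
  have set: "set w = (\<lambda>i. (a i, b i)) ` {1..n}"
    unfolding wab[symmetric] by (auto simp del: upt_Suc)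
  have "a ` {1..n} = {1..n}" "b ` {1..n} = {1..n}"
  proof -
    have W: "(\<lambda>i. (a i, b i)) ` {1..n} = perm_points n \<eta>" using w set by (simp add: words_def)
    show "a ` {1..n} = {1..n}" using P(2) unfolding W[symmetric] image_image by simp
    show "b ` {1..n} = {1..n}" using P(3) unfolding W[symmetric] image_image by simp
  qed
  then have "a permutes {1..n}" "b permutes {1..n}"
    using permI[of a] permI[of b] unfolding a_def b_def by simp_all
  moreover have "{(a i, b i) | i. i \<in> {1..n}} = perm_points n \<eta>"
    using set w unfolding words_def Setcompr_eq_image by simp
  moreover have "\<not> common_rise_at n a b i" for i
  proof
    assume r: "common_rise_at n a b i"
    then have i: "1 \<le> i" "Suc i \<le> n" by (auto simp: common_rise_at_def)
    then have "steep (w ! (i - 1)) (w ! Suc (i - 1))"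
      using w len successively_nth[of steep w "i - 1"] by (simp add: words_def)
    then show False using r i by (simp add: common_rise_at_def steep_def a_def b_def)
  qed
  ultimately have "(a, b) \<in> no_common_rise_pairs n \<eta>" by (simp add: no_common_rise_pairs_def)
  then show "\<exists>z\<in>no_common_rise_pairs n \<eta>. w = (\<lambda>(a, b). map (\<lambda>i. (a i, b i)) [1..<Suc n]) z"
    using wab by (intro bexI[of _ "(a, b)"]) auto
qed

theorem theorem3:
  fixes n :: nat and \<eta> :: "nat \<Rightarrow> nat"
  assumes "n \<ge> 1" and "\<eta> permutes {1..n}"
  shows "(\<exists>f. bij_betw f (forests_with_leaves n \<eta>) (no_common_rise_pairs n \<eta>)) \<and>
         card (forests_with_leaves n \<eta>) = card (no_common_rise_pairs n \<eta>)"
proof -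
  note P = general_position_perm_points(1)[OF assms(2)]
  note bij = bij_betw_pairs_words[OF assms(2)]
  have fin: "finite (perm_points n \<eta>)" using P by (simp add: general_position_def)
  have "card (forests_with_leaves n \<eta>) = card (no_common_rise_pairs n \<eta>)"
    using bij_betw_same_card[OF bij] card_words_eq_card_forests_on[OF P]
    by (simp add: forests_with_leaves_eq[OF assms(2)])
  moreover have "finite (forests_with_leaves n \<eta>)"
    using finite_forests_on[OF fin] by (simp add: forests_with_leaves_eq[OF assms(2)])
  moreover have "finite (no_common_rise_pairs n \<eta>)"
    using bij_betw_finite[OF bij] finite_words[OF fin] by simp
  \<comment> \<open>The bijection comes from equal finite cardinalities, not from an explicit
    correspondence.\<close>
  ultimately show ?thesis using finite_same_card_bij by blast
qed

end
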